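(* Let $\alpha\in\mathbb{R}$ and let $\gamma$ be a properly immersed $\alpha$-stationary spacelike curve in $\mathbb{L}^2$ contained in $\mathcal{C}^-$. If $\gamma$ is far away from the lightlike cone, then $\alpha>1$.
   Context: $\mathbb{L}^2=(\mathbb{R}^2,\langle\cdot,\cdot\rangle)$ with $\langle\cdot,\cdot\rangle=dx^2-dy^2$. $\mathcal{C}=\{p\in\mathbb{L}^2:\langle p,p\rangle=0\}$ is the lightlike cone and $\mathcal{C}^-=\{p\in\mathbb{L}^2:\langle p,p\rangle<0\}$. A smooth regular curve is spacelike (resp. timelike) if $\langle\gamma',\gamma'\rangle>0$ (resp. $<0$) everywhere. Let $N$ be a unit normal field along $\gamma$ ($\langle N,\gamma'\rangle=0$, $|\langle N,N\rangle|=1$). When $\gamma$ is parametrized by arc-length ($|\langle\gamma',\gamma'\rangle|=1$) its curvature is $\kappa=-\langle N,\gamma''\rangle$. A spacelike or timelike curve $\gamma\colon I\to\mathbb{L}^2$, $I\subset\mathbb{R}$ an interval, with $\gamma(I)\cap\mathcal{C}=\emptyset$ is called $\alpha$-stationary if $\kappa=-\alpha\,\dfrac{\langle N,\gamma\rangle}{|\langle\gamma,\gamma\rangle|}$ along $\gamma$ (this condition does not depend on the choice of sign of $N$). Properly immersed means that the immersion $\gamma\colon I\to\mathbb{L}^2$ is a proper map (preimages of compact sets are compact). A set $S\subset\mathbb{L}^2$ is said to be far away from the lightlike cone if there is $\delta>0$ such that $S\subset\mathcal{C}_\delta:=\{(x,y)\in\mathbb{L}^2: x^2-(y-\delta)^2<0\}$.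 The curve $\gamma$ is far away from the lightlike cone if its image $\gamma(I)$ is.
   Formalization: For curves in the lower half of C^- "far away" is required of the mirror image under y -> -y: read literally it always holds there and the lower hyperbola (1-stationary) is a counterexample. Curves have no endpoints (I is an open interval), since closed segments are counterexamples. *)

theory Defs
  imports "HOL-Analysis.Analysis"
begin

text \<open>Points of the Lorentzian plane are pairs \<open>(x, y)\<close>, with metric \<open>dx\<^sup>2 - dy\<^sup>2\<close>.\<close>

definition lorentz :: "real \<times> real \<Rightarrow> real \<times> real \<Rightarrow> real" where
  "lorentz p q = fst p * fst q - snd p * snd q"

definition light_cone :: "(real \<times> real) set" where
  "light_cone = {p. lorentz p p = 0}"

definition C_minus :: "(real \<times> real) set" where
  "C_minus = {p. lorentz p p < 0}"

definition velocity :: "(real \<Rightarrow> 'a::real_normed_vector) \<Rightarrow> real \<Rightarrow> 'a" where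
  "velocity f t = vector_derivative f (at t)"

text \<open>Infinite differentiability. All parameter sets below are open, so the two-sided
  derivatives at points of \<open>I\<close> depend only on the restriction of \<open>f\<close> to \<open>I\<close>.\<close>

definition smooth_on :: "real set \<Rightarrow> (real \<Rightarrow> 'a::real_normed_vector) \<Rightarrow> bool" where
  "smooth_on I f \<longleftrightarrow> (\<forall>n. \<forall>t\<in>I. (velocity ^^ n) f differentiable (at t))"

definition open_interval :: "real set \<Rightarrow> bool" where
  "open_interval I \<longleftrightarrow> open I \<and> is_interval I \<and> I \<noteq> {}"

definition regular_curve :: "real set \<Rightarrow> (real \<Rightarrow> real \<times> real) \<Rightarrow> bool" where
  "regular_curve I \<gamma> \<longleftrightarrow>
     open_interval I \<and> smooth_on I \<gamma> \<and> (\<forall>t\<in>I. velocity \<gamma> t \<noteq> 0)"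

definition spacelike_curve :: "real set \<Rightarrow> (real \<Rightarrow> real \<times> real) \<Rightarrow> bool" where
  "spacelike_curve I \<gamma> \<longleftrightarrow>
     regular_curve I \<gamma> \<and> (\<forall>t\<in>I. lorentz (velocity \<gamma> t) (velocity \<gamma> t) > 0)"

definition timelike_curve :: "real set \<Rightarrow> (real \<Rightarrow> real \<times> real) \<Rightarrow> bool" where
  "timelike_curve I \<gamma> \<longleftrightarrow>
     regular_curve I \<gamma> \<and> (\<forall>t\<in>I. lorentz (velocity \<gamma> t) (velocity \<gamma> t) < 0)"

definition unit_normal_field ::
  "real set \<Rightarrow> (real \<Rightarrow> real \<times> real) \<Rightarrow> (real \<Rightarrow> real \<times> real) \<Rightarrow> bool" where
  "unit_normal_field I \<gamma> N \<longleftrightarrow>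
     smooth_on I N \<and>
     (\<forall>t\<in>I. lorentz (N t) (velocity \<gamma> t) = 0 \<and> \<bar>lorentz (N t) (N t)\<bar> = 1)"

definition arclength_parametrized :: "real set \<Rightarrow> (real \<Rightarrow> real \<times> real) \<Rightarrow> bool" where
  "arclength_parametrized I \<gamma> \<longleftrightarrow>
     (\<forall>t\<in>I. \<bar>lorentz (velocity \<gamma> t) (velocity \<gamma> t)\<bar> = 1)"

text \<open>The following formula is the curvature with respect to the normal \<open>N\<close> only when
  \<open>\<gamma>\<close> is parametrized by arc-length; it is applied only to such curves.\<close>

definition arclength_curvature ::
  "(real \<Rightarrow> real \<times> real) \<Rightarrow> (real \<Rightarrow> real \<times> real) \<Rightarrow> real \<Rightarrow> real" where
  "arclength_curvature N \<gamma> t = - lorentz (N t) (velocity (velocity \<gamma>) t)"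

text \<open>\<open>\<phi>\<close> is a diffeomorphism from \<open>J\<close> onto \<open>I\<close>; it may reverse the orientation.\<close>

definition change_of_parameter :: "real set \<Rightarrow> real set \<Rightarrow> (real \<Rightarrow> real) \<Rightarrow> bool" where
  "change_of_parameter J I \<phi> \<longleftrightarrow>
     open_interval J \<and> bij_betw \<phi> J I \<and> smooth_on J \<phi> \<and> (\<forall>s\<in>J. velocity \<phi> s \<noteq> 0)"

text \<open>The curve need not be parametrized by arc-length itself, so the equation is imposed on an
  arc-length reparametrization \<open>\<gamma> \<circ> \<phi>\<close>. It is invariant under replacing \<open>N\<close> by \<open>- N\<close> and
  under \<open>s \<mapsto> \<plusminus> s + c\<close>, so it does not matter which reparametrization and which unit normal
  are chosen.\<close>

definition stationary_curve :: "real \<Rightarrow> real set \<Rightarrow> (real \<Rightarrow> real \<times> real) \<Rightarrow> bool" where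
  "stationary_curve \<alpha> I \<gamma> \<longleftrightarrow>
     (spacelike_curve I \<gamma> \<or> timelike_curve I \<gamma>) \<and>
     \<gamma> ` I \<inter> light_cone = {} \<and>
     (\<exists>J \<phi> N. change_of_parameter J I \<phi> \<and>
        arclength_parametrized J (\<gamma> \<circ> \<phi>) \<and>
        unit_normal_field J (\<gamma> \<circ> \<phi>) N \<and>
        (\<forall>s\<in>J. arclength_curvature N (\<gamma> \<circ> \<phi>) s =
           - \<alpha> * (lorentz (N s) (\<gamma> (\<phi> s)) / \<bar>lorentz (\<gamma> (\<phi> s)) (\<gamma> (\<phi> s))\<bar>)))"

definition properly_immersed :: "real set \<Rightarrow> (real \<Rightarrow> real \<times> real) \<Rightarrow> bool" where
  "properly_immersed I \<gamma> \<longleftrightarrow>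
     regular_curve I \<gamma> \<and> (\<forall>K. compact K \<longrightarrow> compact {t\<in>I. \<gamma> t \<in> K})"

definition C_delta :: "real \<Rightarrow> (real \<times> real) set" where
  "C_delta \<delta> = {(x, y). x\<^sup>2 - (y - \<delta>)\<^sup>2 < 0}"

text \<open>The shift by \<open>\<delta> > 0\<close> points upwards, so this condition is the intended one only for
  sets in the half-plane \<open>y > 0\<close>: every subset of \<^const>\<open>C_minus\<close> with \<open>y < 0\<close> lies in
  \<^term>\<open>C_delta \<delta>\<close> for all \<open>\<delta> > 0\<close>. Sets in the half-plane \<open>y < 0\<close> have to be reflected
  first.\<close>

definition far_from_light_cone :: "(real \<times> real) set \<Rightarrow> bool" where
  "far_from_light_cone S \<longleftrightarrow> (\<exists>\<delta>>0. S \<subseteq> C_delta \<delta>)"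

definition reflection :: "real \<times> real \<Rightarrow> real \<times> real" where
  "reflection p = (fst p, - snd p)"

end

theory Submission
  imports Defs "HOL-Real_Asymp.Real_Asymp"
begin

text \<open>
  The idea is that the stationary equation can be integrated twice in null coordinates.
  After a reflection the curve lies in \<open>y > 0\<close>. Write \<open>p = y + x\<close> and \<open>q = y - x\<close>,
  which are positive on the upper component of \<^const>\<open>C_minus\<close>, and let
  \<open>P = p'\<close>, \<open>Q = - q'\<close> for an arc-length parameter, so that \<open>P Q = 1\<close>. The stationary
  equation becomes \<open>(ln (P / Q))' = \<alpha> (ln (p / q))'\<close>, whence \<open>P / Q = C (p / q)\<^sup>\<alpha>\<close> with a
  constant \<open>C > 0\<close>. By separation of variables, \<open>p\<^bsup>-\<alpha>\<^esup> p' + C q\<^bsup>-\<alpha>\<^esup> q' = 0\<close>, so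
  \<open>F p + C F q\<close> is constant along the curve, where \<open>F\<close> is a primitive of \<open>t\<^bsup>-\<alpha>\<^esup>\<close>.

  If \<open>\<alpha> \<le> 1\<close>, then \<open>F\<close> is increasing and unbounded at infinity. Being far away from the
  cone keeps \<open>p\<close> and \<open>q\<close> above \<open>\<delta>\<close>, so each of \<open>F p\<close> and \<open>F q\<close> is bounded below; as a
  positive combination of them is constant, each is also bounded above, and then so are \<open>p\<close>
  and \<open>q\<close>. The curve thus stays in a compact set, and properness makes its parameter interval
  compact, which a nonempty open interval is not. For \<open>\<alpha> > 1\<close> the primitive is bounded at
  infinity, and a bound on \<open>F p\<close> no longer bounds \<open>p\<close>.

  The set \<open>C_delta \<delta>\<close> also meets the upper component in the bounded square
  \<open>\<bar>x\<bar> < y < \<delta> - \<bar>x\<bar>\<close>; points of the curve in that square do no harm, since only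
  boundedness is at stake.
\<close>

section \<open>Primitives of real powers\<close>

definition powr_primitive :: "real \<Rightarrow> real \<Rightarrow> real" where
  "powr_primitive \<alpha> t = (if \<alpha> = 1 then ln t else t powr (1 - \<alpha>) / (1 - \<alpha>))"

lemma powr_primitive_has_derivative:
  assumes "t > 0"
  shows "(powr_primitive \<alpha> has_real_derivative t powr (- \<alpha>)) (at t)"
proof (cases "\<alpha> = 1")
  case True
  then show ?thesis
    using assms unfolding powr_primitive_def
    by (auto intro!: derivative_eq_intros simp: powr_minus divide_simps)
next
  case False
  have "((\<lambda>t. t powr (1 - \<alpha>) / (1 - \<alpha>)) has_real_derivative
      (1 - \<alpha>) * t powr (1 - \<alpha> - 1) / (1 - \<alpha>)) (at t)"
    using assms has_real_derivative_powr[of t "1 - \<alpha>"] by (intro DERIV_cdivide) auto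
  then show ?thesis
    using False by (simp add: powr_primitive_def[abs_def])
qed

lemma powr_primitive_mono:
  assumes "0 < s" "s \<le> t"
  shows "powr_primitive \<alpha> s \<le> powr_primitive \<alpha> t"
proof (rule DERIV_nonneg_imp_nondecreasing[OF assms(2)])
  fix x assume "s \<le> x" "x \<le> t"
  then show "\<exists>y. (powr_primitive \<alpha> has_real_derivative y) (at x) \<and> 0 \<le> y"
    using assms powr_primitive_has_derivative[of x \<alpha>] by (intro exI[of _ "x powr (- \<alpha>)"]) auto
qed

text \<open>The integral of \<open>t\<^bsup>-\<alpha>\<^esup>\<close> diverges at infinity exactly when \<open>\<alpha> \<le> 1\<close>; this is the source
  of the bound \<open>\<alpha> > 1\<close> for stationary curves.\<close>

lemma powr_primitive_at_top:
  assumes "\<alpha> \<le> 1"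
  shows "filterlim (powr_primitive \<alpha>) at_top at_top"
proof (cases "\<alpha> = 1")
  case True
  then have "powr_primitive \<alpha> = ln" by (auto simp: powr_primitive_def)
  then show ?thesis using ln_at_top by simp
next
  case False
  then have "0 < 1 - \<alpha>" using assms by simp
  have "filterlim (\<lambda>t. t powr (1 - \<alpha>)) at_top at_top"
    using \<open>0 < 1 - \<alpha>\<close> by (rule real_powr_at_top)
  then have "filterlim (\<lambda>t. inverse (1 - \<alpha>) * t powr (1 - \<alpha>)) at_top at_top"
    using \<open>0 < 1 - \<alpha>\<close> by (intro filterlim_tendsto_pos_mult_at_top[OF tendsto_const]) auto
  then show ?thesis
    using False by (simp add: powr_primitive_def[abs_def] field_simps)
qed

section \<open>The equation in null coordinates\<close>

text \<open>Because \<open>P Q = 1\<close>, the hypothesis \<open>ode\<close> says that \<open>P / Q\<close> and \<open>(p / q)\<^sup>\<alpha>\<close> have the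
  same logarithmic derivative, so that their quotient is constant. The conclusion is arranged
  so that the variables \<open>p\<close> and \<open>q\<close> are separated.\<close>

lemma null_coordinates_first_integral:
  fixes p q P Q P' Q' :: "real \<Rightarrow> real"
  assumes "convex J"
    and p: "\<And>s. s \<in> J \<Longrightarrow> (p has_real_derivative P s) (at s)"
    and q: "\<And>s. s \<in> J \<Longrightarrow> (q has_real_derivative - Q s) (at s)"
    and P: "\<And>s. s \<in> J \<Longrightarrow> (P has_real_derivative P' s) (at s)"
    and Q: "\<And>s. s \<in> J \<Longrightarrow> (Q has_real_derivative Q' s) (at s)"
    and PQ: "\<And>s. s \<in> J \<Longrightarrow> P s * Q s = 1"
    and pos: "\<And>s. s \<in> J \<Longrightarrow> p s > 0" "\<And>s. s \<in> J \<Longrightarrow> q s > 0"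
    and ode: "\<And>s. s \<in> J \<Longrightarrow> P' s * Q s - P s * Q' s = \<alpha> * (P s / p s + Q s / q s)"
  obtains C where "C > 0"
    and "\<And>s. s \<in> J \<Longrightarrow> p s powr (- \<alpha>) * P s = C * (q s powr (- \<alpha>) * Q s)"
proof -
  define H where "H s = (P s / Q s) * (p s powr (- \<alpha>) * q s powr \<alpha>)" for s
  have "(H has_real_derivative 0) (at s)" if s: "s \<in> J" for s
  proof -
    have Q0: "Q s \<noteq> 0" and P0: "P s \<noteq> 0" using PQ[OF s] by auto
    then have QP: "Q s = 1 / P s" using PQ[OF s] by (simp add: eq_divide_eq mult.commute)
    have dp: "((\<lambda>s. p s powr (- \<alpha>)) has_real_derivative
        - \<alpha> * p s powr (- \<alpha>) / p s * P s) (at s)"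
      using pos[OF s] p[OF s]
      by (auto intro!: derivative_eq_intros simp: field_simps powr_diff)
    have dq: "((\<lambda>s. q s powr \<alpha>) has_real_derivative
        \<alpha> * q s powr \<alpha> / q s * (- Q s)) (at s)"
      using pos[OF s] q[OF s]
      by (auto intro!: derivative_eq_intros simp: field_simps powr_diff)
    have "((\<lambda>s. P s / Q s) has_real_derivative
        (P' s * Q s - P s * Q' s) / (Q s * Q s)) (at s)"
      by (rule DERIV_divide[OF P[OF s] Q[OF s] Q0])
    from DERIV_mult[OF this DERIV_mult[OF dp dq]]
    have "(H has_real_derivative
       (P' s * Q s - P s * Q' s) / (Q s * Q s) * (p s powr (- \<alpha>) * q s powr \<alpha>)
       + (- \<alpha> * p s powr (- \<alpha>) / p s * P s * q s powr \<alpha>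
          + \<alpha> * q s powr \<alpha> / q s * (- Q s) * p s powr (- \<alpha>)) * (P s / Q s)) (at s)"
      unfolding H_def[abs_def] .
    moreover have "(P' s * Q s - P s * Q' s) / (Q s * Q s) * (p s powr (- \<alpha>) * q s powr \<alpha>)
       + (- \<alpha> * p s powr (- \<alpha>) / p s * P s * q s powr \<alpha>
          + \<alpha> * q s powr \<alpha> / q s * (- Q s) * p s powr (- \<alpha>)) * (P s / Q s) = 0"
      using pos[OF s] P0 unfolding ode[OF s] unfolding QP by (simp add: field_simps)
    ultimately show ?thesis by simp
  qed
  then obtain C where C: "\<And>s. s \<in> J \<Longrightarrow> H s = C"
    using has_field_derivative_zero_constant[OF \<open>convex J\<close>, of H]
    by (meson has_field_derivative_at_within)
  show thesis
  proof (cases "J = {}")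
    case True
    then show thesis using that[of 1] by auto
  next
    case False
    then obtain s where s: "s \<in> J" by auto
    have "0 < P s / Q s"
      using PQ[OF s] by (metis zero_less_divide_iff zero_less_mult_iff zero_less_one)
    then have "C > 0"
      using pos[OF s] unfolding C[OF s, symmetric] H_def by (intro mult_pos_pos) auto
    moreover have "p s powr (- \<alpha>) * P s = C * (q s powr (- \<alpha>) * Q s)" if "s \<in> J" for s
    proof -
      have "Q s \<noteq> 0" using PQ[OF that] by auto
      then show ?thesis
        using C[OF that] pos[OF that] by (simp add: H_def powr_minus field_simps)
    qed
    ultimately show thesis using that by blast
  qed
qed

text \<open>Integrating the separated equation shows that \<open>F p + C F q\<close> is constant for the
  primitive \<open>F\<close> of \<open>t\<^bsup>-\<alpha>\<^esup>\<close>. A lower bound on one null coordinate is therefore an upper bound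
  on the other.\<close>

lemma null_coordinates_bounded:
  fixes p q P Q P' Q' :: "real \<Rightarrow> real"
  assumes "\<alpha> \<le> 1" "\<delta> > 0" "convex J"
    and p: "\<And>s. s \<in> J \<Longrightarrow> (p has_real_derivative P s) (at s)"
    and q: "\<And>s. s \<in> J \<Longrightarrow> (q has_real_derivative - Q s) (at s)"
    and P: "\<And>s. s \<in> J \<Longrightarrow> (P has_real_derivative P' s) (at s)"
    and Q: "\<And>s. s \<in> J \<Longrightarrow> (Q has_real_derivative Q' s) (at s)"
    and PQ: "\<And>s. s \<in> J \<Longrightarrow> P s * Q s = 1"
    and pos: "\<And>s. s \<in> J \<Longrightarrow> p s > 0" "\<And>s. s \<in> J \<Longrightarrow> q s > 0"
    and ode: "\<And>s. s \<in> J \<Longrightarrow> P' s * Q s - P s * Q' s = \<alpha> * (P s / p s + Q s / q s)"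
  obtains B where "\<And>s. s \<in> J \<Longrightarrow> \<delta> \<le> p s \<Longrightarrow> \<delta> \<le> q s \<Longrightarrow> p s \<le> B \<and> q s \<le> B"
proof -
  let ?F = "powr_primitive \<alpha>"
  obtain C where "C > 0"
    and C: "\<And>s. s \<in> J \<Longrightarrow> p s powr (- \<alpha>) * P s = C * (q s powr (- \<alpha>) * Q s)"
    using null_coordinates_first_integral[OF assms(3) p q P Q PQ pos ode] by blast
  have "((\<lambda>s. ?F (p s) + C * ?F (q s)) has_real_derivative 0) (at s)" if s: "s \<in> J" for s
  proof -
    have "((\<lambda>s. ?F (p s) + C * ?F (q s)) has_real_derivative
        p s powr (- \<alpha>) * P s + C * (q s powr (- \<alpha>) * (- Q s))) (at s)"
      using DERIV_chain2[OF powr_primitive_has_derivative p[OF s]]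
        DERIV_chain2[OF powr_primitive_has_derivative q[OF s]] pos[OF s]
      by (intro DERIV_add DERIV_cmult) auto
    then show ?thesis using C[OF s] by simp
  qed
  then obtain D where D: "\<And>s. s \<in> J \<Longrightarrow> ?F (p s) + C * ?F (q s) = D"
    using has_field_derivative_zero_constant[OF \<open>convex J\<close>, of "\<lambda>s. ?F (p s) + C * ?F (q s)"]
    by (meson has_field_derivative_at_within)
  define M where "M = max (D - C * ?F \<delta>) ((D - ?F \<delta>) / C)"
  have "eventually (\<lambda>t. ?F t > M) at_top"
    using powr_primitive_at_top[OF \<open>\<alpha> \<le> 1\<close>] by (simp add: filterlim_at_top_dense)
  then obtain B where B: "\<And>t. t \<ge> B \<Longrightarrow> ?F t > M"
    by (auto simp: eventually_at_top_linorder)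
  have "p s \<le> B \<and> q s \<le> B" if s: "s \<in> J" "\<delta> \<le> p s" "\<delta> \<le> q s" for s
  proof -
    have "?F \<delta> \<le> ?F (p s)" "?F \<delta> \<le> ?F (q s)"
      using s \<open>\<delta> > 0\<close> by (auto intro: powr_primitive_mono)
    moreover have "C * ?F \<delta> \<le> C * ?F (q s)"
      using calculation(2) \<open>C > 0\<close> by simp
    ultimately have "?F (p s) \<le> D - C * ?F \<delta>" "?F (q s) * C \<le> D - ?F \<delta>"
      using D[OF s(1)] by (auto simp: mult.commute)
    then have "?F (p s) \<le> M" "?F (q s) \<le> M"
      using \<open>C > 0\<close> by (auto simp: M_def pos_le_divide_eq le_max_iff_disj)
    then show ?thesis
      using B[of "p s"] B[of "q s"] by linarith
  qed
  then show thesis using that by blast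
qed

section \<open>The stationary equation of a spacelike curve\<close>

text \<open>A normal of the unit spacelike vector \<open>(x', y')\<close> is a multiple \<open>\<lambda> (y', x')\<close>, and \<open>\<lambda>\<close>
  cancels from the stationary equation.\<close>

lemma stationary_equation_without_normal:
  fixes x y x' y' x'' y'' n m \<alpha> :: real
  assumes unit: "x'\<^sup>2 - y'\<^sup>2 = 1"
    and orth: "n * x' - m * y' = 0" and "n \<noteq> 0 \<or> m \<noteq> 0"
    and eq: "- (n * x'' - m * y'') = - \<alpha> * ((n * x - m * y) / w)"
  shows "y' * x'' - x' * y'' = \<alpha> * ((y' * x - x' * y) / w)"
proof -
  define l where "l = m * x' - n * y'"
  have n: "n = l * y'" and m: "m = l * x'"
    using unit orth unfolding l_def by algebra+
  then have "l \<noteq> 0" using assms(3) by auto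
  have "l * (y' * x'' - x' * y'') = l * (\<alpha> * ((y' * x - x' * y) / w))"
    using eq unfolding n m by (simp add: algebra_simps diff_divide_distrib)
  with \<open>l \<noteq> 0\<close> show ?thesis by (metis mult_left_cancel)
qed

text \<open>The null coordinates are \<open>p = e y + x\<close> and \<open>q = e y - x\<close>, where the sign \<open>e\<close> reflects
  the curve into the upper half-plane. Both sides of the equation change sign under the
  reflection, and \<open>y\<^sup>2 - x\<^sup>2 = p q\<close> splits the right-hand side into partial fractions.\<close>

lemma stationary_equation_null_coordinates:
  fixes x y x' y' x'' y'' e \<alpha> :: real
  assumes e: "e = 1 \<or> e = - 1" and "e * y + x > 0" "e * y - x > 0"
    and eq: "y' * x'' - x' * y'' = \<alpha> * ((y' * x - x' * y) / (y\<^sup>2 - x\<^sup>2))"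
  shows "(e * y'' + x'') * (x' - e * y') - (e * y' + x') * (x'' - e * y'') =
    \<alpha> * ((e * y' + x') / (e * y + x) + (x' - e * y') / (e * y - x))"
proof -
  have ee: "e * e = 1" using e by auto
  have "y\<^sup>2 - x\<^sup>2 = (e * y + x) * (e * y - x)"
    using ee by algebra
  then have "(e * y' + x') / (e * y + x) + (x' - e * y') / (e * y - x) =
      ((e * y' + x') * (e * y - x) + (x' - e * y') * (e * y + x)) / (y\<^sup>2 - x\<^sup>2)"
    using assms(2,3) by (simp add: add_frac_eq)
  also have "(e * y' + x') * (e * y - x) + (x' - e * y') * (e * y + x) =
      - 2 * e * (y' * x - x' * y)"
    by algebra
  finally have "\<alpha> * ((e * y' + x') / (e * y + x) + (x' - e * y') / (e * y - x)) =
      - 2 * e * (y' * x'' - x' * y'')"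
    unfolding eq by simp
  also have "\<dots> = (e * y'' + x'') * (x' - e * y') - (e * y' + x') * (x'' - e * y'')"
    by algebra
  finally show ?thesis by simp
qed

section \<open>Smooth reparametrizations\<close>

lemma smooth_on_velocity:
  assumes "smooth_on I f" "t \<in> I"
  shows "(f has_vector_derivative velocity f t) (at t)"
    and "(velocity f has_vector_derivative velocity (velocity f) t) (at t)"
proof -
  have "(velocity ^^ 0) f differentiable at t" "(velocity ^^ 1) f differentiable at t"
    using assms unfolding smooth_on_def by blast+
  then show "(f has_vector_derivative velocity f t) (at t)"
    and "(velocity f has_vector_derivative velocity (velocity f) t) (at t)"
    by (simp_all add: vector_derivative_works velocity_def)
qed

lemma velocity_reparametrization:
  assumes \<gamma>: "smooth_on I \<gamma>" and \<phi>: "smooth_on J \<phi>" and "\<phi> ` J \<subseteq> I" and s: "s \<in> J"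
  shows "velocity (\<gamma> \<circ> \<phi>) s = velocity \<phi> s *\<^sub>R velocity \<gamma> (\<phi> s)"
    and "((\<gamma> \<circ> \<phi>) has_vector_derivative velocity (\<gamma> \<circ> \<phi>) s) (at s)"
proof -
  have "((\<gamma> \<circ> \<phi>) has_vector_derivative velocity \<phi> s *\<^sub>R velocity \<gamma> (\<phi> s)) (at s)"
    using assms by (intro vector_diff_chain_at smooth_on_velocity(1)[OF \<phi>]
        smooth_on_velocity(1)[OF \<gamma>]) auto
  then show "velocity (\<gamma> \<circ> \<phi>) s = velocity \<phi> s *\<^sub>R velocity \<gamma> (\<phi> s)"
    and "((\<gamma> \<circ> \<phi>) has_vector_derivative velocity (\<gamma> \<circ> \<phi>) s) (at s)"
    by (simp_all add: velocity_def vector_derivative_at)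
qed

lemma velocity_reparametrization_has_derivative:
  assumes \<gamma>: "smooth_on I \<gamma>" and \<phi>: "smooth_on J \<phi>" and "\<phi> ` J \<subseteq> I" and s: "s \<in> J"
    and "open J"
  shows "(velocity (\<gamma> \<circ> \<phi>) has_vector_derivative velocity (velocity (\<gamma> \<circ> \<phi>)) s) (at s)"
proof -
  have "\<phi> s \<in> I" using assms by auto
  have "((velocity \<gamma> \<circ> \<phi>) has_vector_derivative
      velocity \<phi> s *\<^sub>R velocity (velocity \<gamma>) (\<phi> s)) (at s)"
    by (intro vector_diff_chain_at smooth_on_velocity(1)[OF \<phi> s]
        smooth_on_velocity(2)[OF \<gamma> \<open>\<phi> s \<in> I\<close>])
  moreover have "(velocity \<phi> has_real_derivative velocity (velocity \<phi>) s) (at s)"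
    using smooth_on_velocity(2)[OF \<phi> s] by (simp add: has_real_derivative_iff_has_vector_derivative)
  ultimately obtain d where
    "((\<lambda>r. velocity \<phi> r *\<^sub>R (velocity \<gamma> \<circ> \<phi>) r) has_vector_derivative d) (at s)"
    using has_vector_derivative_scaleR by blast
  then have "(velocity (\<gamma> \<circ> \<phi>) has_vector_derivative d) (at s)"
    by (rule has_vector_derivative_transform_within_open[OF _ \<open>open J\<close> s])
      (simp add: velocity_reparametrization(1)[OF \<gamma> \<phi> assms(3)])
  then show ?thesis
    by (metis vector_derivative_at velocity_def)
qed

lemma has_vector_derivative_components:
  fixes f :: "real \<Rightarrow> real \<times> real"
  assumes "(f has_vector_derivative d) (at t)"
  shows "((\<lambda>t. fst (f t)) has_real_derivative fst d) (at t)"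
    and "((\<lambda>t. snd (f t)) has_real_derivative snd d) (at t)"
  using bounded_linear.has_vector_derivative[OF bounded_linear_fst assms]
    bounded_linear.has_vector_derivative[OF bounded_linear_snd assms]
  by (simp_all add: has_real_derivative_iff_has_vector_derivative)

section \<open>Stationary spacelike curves far away from the light cone\<close>

text \<open>The sign \<open>e\<close> treats both components of \<^const>\<open>C_minus\<close> at once. By the hypothesis \<open>far\<close>
  a point of the curve has both null coordinates above \<open>\<delta>\<close>, where the first integral bounds
  them, or both below \<open>\<delta>\<close>.\<close>

lemma stationary_curve_far_bounded:
  assumes st: "stationary_curve \<alpha> I \<gamma>" and sp: "spacelike_curve I \<gamma>"
    and "\<alpha> \<le> 1" "\<delta> > 0" and e: "e = 1 \<or> e = - 1"
    and minus: "\<gamma> ` I \<subseteq> C_minus"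
    and upper: "\<And>t. t \<in> I \<Longrightarrow> e * snd (\<gamma> t) > 0"
    and far: "\<And>t. t \<in> I \<Longrightarrow> (fst (\<gamma> t))\<^sup>2 < (e * snd (\<gamma> t) - \<delta>)\<^sup>2"
  shows "bounded (\<gamma> ` I)"
proof -
  obtain J \<phi> N where cp: "change_of_parameter J I \<phi>"
    and arc: "arclength_parametrized J (\<gamma> \<circ> \<phi>)"
    and nor: "unit_normal_field J (\<gamma> \<circ> \<phi>) N"
    and eq: "\<And>s. s \<in> J \<Longrightarrow> arclength_curvature N (\<gamma> \<circ> \<phi>) s =
           - \<alpha> * (lorentz (N s) (\<gamma> (\<phi> s)) / \<bar>lorentz (\<gamma> (\<phi> s)) (\<gamma> (\<phi> s))\<bar>)"
    using st unfolding stationary_curve_def by blast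
  have J: "open J" "convex J" and img: "\<phi> ` J = I" and \<phi>: "smooth_on J \<phi>"
    and \<phi>0: "\<And>s. s \<in> J \<Longrightarrow> velocity \<phi> s \<noteq> 0"
    using cp by (auto simp: change_of_parameter_def open_interval_def bij_betw_def
        is_interval_convex_1)
  have \<gamma>: "smooth_on I \<gamma>"
    and sl: "\<And>t. t \<in> I \<Longrightarrow> lorentz (velocity \<gamma> t) (velocity \<gamma> t) > 0"
    using sp by (auto simp: spacelike_curve_def regular_curve_def)
  note vel = velocity_reparametrization[OF \<gamma> \<phi> eq_refl[OF img]]
  note acc = velocity_reparametrization_has_derivative[OF \<gamma> \<phi> eq_refl[OF img] _ J(1)]
  define x where "x s = fst ((\<gamma> \<circ> \<phi>) s)" for s
  define y where "y s = snd ((\<gamma> \<circ> \<phi>) s)" for s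
  define x' where "x' s = fst (velocity (\<gamma> \<circ> \<phi>) s)" for s
  define y' where "y' s = snd (velocity (\<gamma> \<circ> \<phi>) s)" for s
  define x'' where "x'' s = fst (velocity (velocity (\<gamma> \<circ> \<phi>)) s)" for s
  define y'' where "y'' s = snd (velocity (velocity (\<gamma> \<circ> \<phi>)) s)" for s
  have dx: "(x has_real_derivative x' s) (at s)" and dy: "(y has_real_derivative y' s) (at s)"
    and ddx: "(x' has_real_derivative x'' s) (at s)"
    and ddy: "(y' has_real_derivative y'' s) (at s)" if "s \<in> J" for s
    using has_vector_derivative_components[OF vel(2)[OF that]]
      has_vector_derivative_components[OF acc[OF that]]
    unfolding x_def[abs_def] y_def[abs_def] x'_def[abs_def] y'_def[abs_def] x''_def y''_def
    by blast+
  have unit: "(x' s)\<^sup>2 - (y' s)\<^sup>2 = 1" if s: "s \<in> J" for s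
  proof -
    have "lorentz (velocity (\<gamma> \<circ> \<phi>) s) (velocity (\<gamma> \<circ> \<phi>) s) =
        (velocity \<phi> s)\<^sup>2 * lorentz (velocity \<gamma> (\<phi> s)) (velocity \<gamma> (\<phi> s))"
      by (simp add: vel(1)[OF s] lorentz_def power2_eq_square algebra_simps)
    moreover have "\<dots> > 0"
      using \<phi>0[OF s] sl[of "\<phi> s"] img s by (intro mult_pos_pos) auto
    ultimately show ?thesis
      using arc s
      by (auto simp: arclength_parametrized_def lorentz_def x'_def y'_def power2_eq_square)
  qed
  have neg: "(x s)\<^sup>2 < (y s)\<^sup>2" and up: "e * y s > 0" if "s \<in> J" for s
    using minus upper[of "\<phi> s"] img that
    by (auto simp: C_minus_def lorentz_def x_def y_def power2_eq_square)
  have pos: "e * y s + x s > 0" "e * y s - x s > 0" if "s \<in> J" for s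
  proof -
    have "(e * y s)\<^sup>2 = (y s)\<^sup>2" using e by auto
    then have "\<bar>x s\<bar> < e * y s"
      using neg[OF that] up[OF that] by (metis abs_of_pos abs_le_square_iff not_le)
    then show "e * y s + x s > 0" "e * y s - x s > 0" by linarith+
  qed
  have stat: "y' s * x'' s - x' s * y'' s =
      \<alpha> * ((y' s * x s - x' s * y s) / ((y s)\<^sup>2 - (x s)\<^sup>2))" if s: "s \<in> J" for s
  proof (rule stationary_equation_without_normal[OF unit[OF s], of "fst (N s)" "snd (N s)"])
    show "fst (N s) * x' s - snd (N s) * y' s = 0"
      using nor s by (auto simp: unit_normal_field_def lorentz_def x'_def y'_def)
    have "\<bar>lorentz (N s) (N s)\<bar> = 1"
      using nor s by (auto simp: unit_normal_field_def)
    then show "fst (N s) \<noteq> 0 \<or> snd (N s) \<noteq> 0"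
      by (auto simp: lorentz_def)
    have "\<bar>lorentz (\<gamma> (\<phi> s)) (\<gamma> (\<phi> s))\<bar> = (y s)\<^sup>2 - (x s)\<^sup>2"
      using neg[OF s] by (simp add: lorentz_def x_def y_def power2_eq_square)
    then show "- (fst (N s) * x'' s - snd (N s) * y'' s) =
        - \<alpha> * ((fst (N s) * x s - snd (N s) * y s) / ((y s)\<^sup>2 - (x s)\<^sup>2))"
      using eq[OF s] by (simp add: arclength_curvature_def lorentz_def x''_def y''_def x_def y_def)
  qed
  obtain B where B: "\<And>s. s \<in> J \<Longrightarrow> \<delta> \<le> e * y s + x s \<Longrightarrow> \<delta> \<le> e * y s - x s \<Longrightarrow>
      e * y s + x s \<le> B \<and> e * y s - x s \<le> B"
  proof (rule null_coordinates_bounded[OF \<open>\<alpha> \<le> 1\<close> \<open>\<delta> > 0\<close> \<open>convex J\<close>,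
        of "\<lambda>s. e * y s + x s" "\<lambda>s. e * y' s + x' s" "\<lambda>s. e * y s - x s" "\<lambda>s. x' s - e * y' s"
          "\<lambda>s. e * y'' s + x'' s" "\<lambda>s. x'' s - e * y'' s"])
    fix s assume s: "s \<in> J"
    show "((\<lambda>s. e * y s + x s) has_real_derivative e * y' s + x' s) (at s)"
      "((\<lambda>s. e * y s - x s) has_real_derivative - (x' s - e * y' s)) (at s)"
      "((\<lambda>s. e * y' s + x' s) has_real_derivative e * y'' s + x'' s) (at s)"
      "((\<lambda>s. x' s - e * y' s) has_real_derivative x'' s - e * y'' s) (at s)"
      using dx[OF s] dy[OF s] ddx[OF s] ddy[OF s] by (auto intro!: derivative_eq_intros)
    show "(e * y' s + x' s) * (x' s - e * y' s) = 1"
      using unit[OF s] e by (auto simp: power2_eq_square algebra_simps)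
    show "e * y s + x s > 0" "e * y s - x s > 0" by (rule pos[OF s])+
    show "(e * y'' s + x'' s) * (x' s - e * y' s) - (e * y' s + x' s) * (x'' s - e * y'' s) =
        \<alpha> * ((e * y' s + x' s) / (e * y s + x s) + (x' s - e * y' s) / (e * y s - x s))"
      by (rule stationary_equation_null_coordinates[OF e pos[OF s] stat[OF s]])
  qed blast
  \<comment> \<open>\<open>2 * \<delta>\<close> bounds the null coordinates on the square, since \<open>p + q = 2 e y < 2 \<delta>\<close> there.\<close>
  define R where "R = max B (2 * \<delta>)"
  have "norm (\<gamma> t) \<le> 2 * R" if t: "t \<in> I" for t
  proof -
    obtain s where s: "s \<in> J" "t = \<phi> s" using img t by auto
    have "(x s)\<^sup>2 < (e * y s - \<delta>)\<^sup>2"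
      using far[OF t] s by (simp add: x_def y_def)
    then have lt: "\<bar>x s\<bar> < \<bar>e * y s - \<delta>\<bar>"
      by (metis abs_le_square_iff not_le)
    have "e * y s + x s \<le> R \<and> e * y s - x s \<le> R"
    proof (cases "e * y s \<ge> \<delta>")
      case True
      then show ?thesis using B[OF s(1)] lt unfolding R_def by fastforce
    next
      case False
      then show ?thesis using lt pos[OF s(1)] unfolding R_def by linarith
    qed
    then have "\<bar>x s\<bar> \<le> R" "\<bar>e * y s\<bar> \<le> R"
      using pos[OF s(1)] by linarith+
    then have "\<bar>x s\<bar> \<le> R" "\<bar>y s\<bar> \<le> R" using e by auto
    then show ?thesis
      using norm_Pair_le[of "x s" "y s"] s by (simp add: x_def y_def)
  qed
  then show ?thesis by (auto simp: bounded_iff)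
qed

text \<open>A bounded proper curve would have a compact parameter set, but the parameter set is open
  and nonempty.\<close>

lemma properly_immersed_unbounded:
  assumes "properly_immersed I \<gamma>"
  shows "\<not> bounded (\<gamma> ` I)"
proof
  assume "bounded (\<gamma> ` I)"
  then obtain R where "\<And>t. t \<in> I \<Longrightarrow> norm (\<gamma> t) \<le> R"
    by (auto simp: bounded_iff)
  then have "{t\<in>I. \<gamma> t \<in> cball 0 R} = I" by auto
  moreover have "compact {t\<in>I. \<gamma> t \<in> cball 0 R}"
    using assms compact_cball unfolding properly_immersed_def by blast
  ultimately have "compact I" by simp
  moreover have "open I" "I \<noteq> {}"
    using assms by (auto simp: properly_immersed_def regular_curve_def open_interval_def)
  ultimately show False using compact_open by blast
qed

theorem theorem2p4:
  fixes \<alpha> :: real and I :: "real set" and \<gamma> :: "real \<Rightarrow> real \<times> real"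
  assumes "stationary_curve \<alpha> I \<gamma>"
    and "spacelike_curve I \<gamma>"
    and "properly_immersed I \<gamma>"
    and "\<gamma> ` I \<subseteq> C_minus"
    and "(\<forall>t\<in>I. snd (\<gamma> t) > 0) \<and> far_from_light_cone (\<gamma> ` I) \<or>
         (\<forall>t\<in>I. snd (\<gamma> t) < 0) \<and> far_from_light_cone (reflection ` \<gamma> ` I)"
  shows "\<alpha> > 1"
proof (rule ccontr)
  assume "\<not> \<alpha> > 1"
  then have "\<alpha> \<le> 1" by simp
  obtain e \<delta> where e: "e = 1 \<or> e = - 1" and "\<delta> > 0"
    and upper: "\<And>t. t \<in> I \<Longrightarrow> e * snd (\<gamma> t) > 0"
    and far: "\<And>t. t \<in> I \<Longrightarrow> (fst (\<gamma> t))\<^sup>2 < (e * snd (\<gamma> t) - \<delta>)\<^sup>2"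
    using assms(5)
  proof (elim disjE conjE)
    assume "\<forall>t\<in>I. snd (\<gamma> t) > 0" "far_from_light_cone (\<gamma> ` I)"
    then show thesis
      using that[of 1] by (fastforce simp: far_from_light_cone_def C_delta_def split: prod.splits)
  next
    assume "\<forall>t\<in>I. snd (\<gamma> t) < 0" "far_from_light_cone (reflection ` \<gamma> ` I)"
    then show thesis
      using that[of "- 1"]
      by (fastforce simp: far_from_light_cone_def C_delta_def reflection_def)
  qed
  have "bounded (\<gamma> ` I)"
    by (rule stationary_curve_far_bounded[OF assms(1,2) \<open>\<alpha> \<le> 1\<close> \<open>\<delta> > 0\<close> e assms(4) upper far])
  then show False
    using properly_immersed_unbounded[OF assms(3)] by blast
qed

end
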